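(* Let $\Theta_1,\Theta_2$ be sets, let $(\mathcal X_1,\mathcal A_1)$ and $(\mathcal X_2,\mathcal A_2)$ be measurable spaces, and let $\mathcal Q:=\{Q_{\theta_1}:\theta_1\in\Theta_1\}\subseteq\mathrm{Prob}(\mathcal X_1,\mathcal A_1)$, $\mathcal R:=\{R_{\theta_1,\theta_2}:\theta_1\in\Theta_1,\theta_2\in\Theta_2\}\subseteq\mathrm{Prob}(\mathcal X_2,\mathcal A_2)$, and $\mathcal P:=\{Q_{\theta_1}\otimes R_{\theta_1,\theta_2}:\theta_1\in\Theta_1,\theta_2\in\Theta_2\}$ be models with these properties: (i) $\mathcal Q$ is complete. (ii) For each $\theta_1\in\Theta_1$, $\{R_{\theta_1,\theta_2}:\theta_2\in\Theta_2\}$ is complete. (iii) For each $\theta_2\in\Theta_2$, $\{R_{\theta_1,\theta_2}:\theta_1\in\Theta_1\}$ is homogeneous. (iv) $\mathcal L^1(\mathcal P)=\mathcal L^1(\{Q_{\theta_1}\otimes R_{\theta_1',\theta_2}:\theta_1,\theta_1'\in\Theta_1,\theta_2\in\Theta_2\})$. Then $\mathcal P$ is complete.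
   Context: $\mathrm{Prob}(\mathcal X,\mathcal A)$ denotes the set of all probability measures (laws) on a measurable space $(\mathcal X,\mathcal A)$. A model on $(\mathcal X,\mathcal A)$ is a subset of $\mathrm{Prob}(\mathcal X,\mathcal A)$; here $\mathcal P$ is a model on $(\mathcal X_1\times\mathcal X_2,\mathcal A_1\otimes\mathcal A_2)$. For a law $P$ and a function $h$, $Ph$ denotes $\int h\,dP$. For a model $\mathcal P$ on $(\mathcal X,\mathcal A)$, $\mathcal L^1(\mathcal P):=\bigcap_{P\in\mathcal P}\mathcal L^1(P)$ is the set of all measurable functions $h:\mathcal X\to\mathbb R$ that are integrable with respect to every $P\in\mathcal P$. A model $\mathcal P$ on $(\mathcal X,\mathcal A)$ is complete if every $h\in\mathcal L^1(\mathcal P)$ with $Ph=0$ for all $P\in\mathcal P$ satisfies $h=0$ $P$-a.s. for every $P\in\mathcal P$. A model is homogeneous if its members are mutually absolutely continuous. *)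

theory Defs
  imports "HOL-Probability.Probability"
begin

text \<open>A measurable space is represented by a value \<open>M\<close> of type \<open>'a measure\<close> of which only
  \<open>space M\<close> and \<open>sets M\<close> are used. A model on \<open>M\<close> is a subset of \<open>Prob M\<close>.\<close>

abbreviation Prob :: "'a measure \<Rightarrow> 'a measure set" where
  "Prob M \<equiv> space (prob_algebra M)"

text \<open>Measurability is demanded separately, so that the empty model yields all real-valued measurable
  functions. Functions are total on the type; values outside \<open>space M\<close> are irrelevant.\<close>

definition L1 :: "'a measure \<Rightarrow> 'a measure set \<Rightarrow> ('a \<Rightarrow> real) set" where
  "L1 M \<P> = {h \<in> borel_measurable M. \<forall>P\<in>\<P>. integrable P h}"

definition complete_model :: "'a measure \<Rightarrow> 'a measure set \<Rightarrow> bool" where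
  "complete_model M \<P> \<longleftrightarrow>
    (\<forall>h\<in>L1 M \<P>. (\<forall>P\<in>\<P>. (\<integral>x. h x \<partial>P) = 0) \<longrightarrow> (\<forall>P\<in>\<P>. AE x in P. h x = 0))"

definition homogeneous_model :: "'a measure set \<Rightarrow> bool" where
  "homogeneous_model \<P> \<longleftrightarrow> (\<forall>P\<in>\<P>. \<forall>P'\<in>\<P>. absolutely_continuous P P')"

end

theory Submission
  imports Defs
begin

text \<open>Let \<open>h\<close> integrate to zero under every \<open>Q i \<Otimes>\<^sub>M R i j\<close>. Fubini's theorem and the completeness of
  \<open>{R i j | j}\<close> show that the average \<open>y \<mapsto> \<integral>h(x,y) \<partial>Q i\<close> vanishes \<open>R i j\<close>-almost everywhere, and
  homogeneity turns this into \<open>R k j\<close>-almost everywhere for every \<open>k\<close>. The second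
  law is thereby decoupled from the index \<open>i\<close>: for fixed \<open>k\<close> and \<open>j\<close> one would like to use the
  completeness of \<open>Q\<close> on the sections \<open>h(\<cdot>,y)\<close>.

  This cannot be done for one \<open>y\<close> at a time, because the exceptional null set of \<open>y\<close> depends on \<open>i\<close> and
  there may be uncountably many \<open>i\<close>. Instead, completeness is applied to the set integrals
  \<open>x \<mapsto> \<integral>y\<in>B. h(x,y) \<partial>R k j\<close>, for which a null set depending on \<open>i\<close> is harmless
  (\<open>AE_zero_if_averages_zero_of_complete_model\<close>). So these vanish \<open>Q i\<close>-almost everywhere for each measurable
  \<open>B\<close>; then \<open>h\<close> integrates to zero over all rectangles, and the rectangles determine \<open>h\<close> almost
  everywhere. The hypothesis on \<open>L1\<close> is what makes the crossed
  integrals, with respect to \<open>Q i \<Otimes>\<^sub>M R k j\<close> for \<open>i \<noteq> k\<close>, meaningful.\<close>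

text \<open>The sets with vanishing integral form a Dynkin system, so by the \<open>\<pi>\<close>-\<open>\<lambda>\<close> theorem they are all of
  \<open>sets M\<close>, and an integrable function is determined almost everywhere by its set integrals.
  Having the whole space in the generator is what gives closure under complements.\<close>

lemma AE_zero_if_set_integrals_zero_on_generator:
  fixes h :: "'a \<Rightarrow> real"
  assumes gen: "sets M = sigma_sets (space M) G"
    and G: "Int_stable G" "space M \<in> G"
    and h: "integrable M h"
    and zero: "\<And>A. A \<in> G \<Longrightarrow> (\<integral>x\<in>A. h x \<partial>M) = 0"
  shows "AE x in M. h x = 0"
proof -
  have G_sets: "G \<subseteq> Pow (space M)"
    using gen sets.sets_into_space by blast
  have h_set: "set_integrable M A h" if "A \<in> sets M" for A
    unfolding set_integrable_def using that h by (rule integrable_mult_indicator)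
  have "(\<integral>x\<in>A. h x \<partial>M) = 0" if "A \<in> sets M" for A
    using G(1) G_sets that unfolding gen
  proof (induction rule: sigma_sets_induct_disjoint)
    case (basic A)
    then show ?case by (rule zero)
  next
    case empty
    show ?case by (simp add: set_lebesgue_integral_def)
  next
    case (compl A)
    then have A: "A \<in> sets M" by (simp add: gen)
    have "(\<integral>x\<in>space M. h x \<partial>M) = (\<integral>x\<in>A \<union> (space M - A). h x \<partial>M)"
      using sets.sets_into_space[OF A] by (simp add: Un_absorb1)
    also have "\<dots> = (\<integral>x\<in>A. h x \<partial>M) + (\<integral>x\<in>space M - A. h x \<partial>M)"
      using A by (intro set_integral_Un h_set) auto
    finally show ?case using compl zero[OF G(2)] by simp
  next
    case (union A)
    then have A: "\<And>i. A i \<in> sets M" by (auto simp: gen)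
    have "(\<integral>x\<in>(\<Union>i. A i). h x \<partial>M) = (\<Sum>i. (\<integral>x\<in>A i. h x \<partial>M))"
      using union(1) A
      by (intro lebesgue_integral_countable_add h_set) (auto simp: disjoint_family_on_def)
    then show ?case using union by simp
  qed
  then show ?thesis
    using h by (intro density_unique_real) (simp_all add: set_lebesgue_integral_def)
qed

text \<open>The exceptional set of \<open>x\<close> may depend on \<open>B\<close>: integrating over \<open>x \<in> A\<close> discards it, which leaves the
  integral of \<open>h\<close> over the rectangle \<open>A \<times> B\<close>.\<close>

lemma (in pair_sigma_finite) AE_zero_if_section_set_integrals_zero:
  fixes h :: "'a \<times> 'b \<Rightarrow> real"
  assumes h: "integrable (M1 \<Otimes>\<^sub>M M2) h"
    and zero: "\<And>B. B \<in> sets M2 \<Longrightarrow> AE x in M1. (\<integral>y\<in>B. h (x, y) \<partial>M2) = 0"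
  shows "AE z in M1 \<Otimes>\<^sub>M M2. h z = 0"
proof (rule AE_zero_if_set_integrals_zero_on_generator[OF _ Int_stable_pair_measure_generator _ h])
  show "sets (M1 \<Otimes>\<^sub>M M2) =
      sigma_sets (space (M1 \<Otimes>\<^sub>M M2)) {a \<times> b |a b. a \<in> sets M1 \<and> b \<in> sets M2}"
    by (simp add: sets_pair_measure space_pair_measure)
  show "space (M1 \<Otimes>\<^sub>M M2) \<in> {a \<times> b |a b. a \<in> sets M1 \<and> b \<in> sets M2}"
    by (auto simp: space_pair_measure)
  fix S assume "S \<in> {a \<times> b |a b. a \<in> sets M1 \<and> b \<in> sets M2}"
  then obtain A B where S: "S = A \<times> B" and A: "A \<in> sets M1" and B: "B \<in> sets M2"
    by blast
  have "(\<integral>z\<in>S. h z \<partial>(M1 \<Otimes>\<^sub>M M2)) =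
      (\<integral>x. (\<integral>y. indicator S (x, y) *\<^sub>R h (x, y) \<partial>M2) \<partial>M1)"
    unfolding set_lebesgue_integral_def S using A B h
    by (intro integral_fst'[symmetric] integrable_mult_indicator) auto
  also have "\<dots> = (\<integral>x\<in>A. (\<integral>y\<in>B. h (x, y) \<partial>M2) \<partial>M1)"
    by (simp add: S set_lebesgue_integral_def indicator_times mult.assoc)
  also have "\<dots> = 0"
    unfolding set_lebesgue_integral_def using zero[OF B]
    by (intro integral_eq_zero_AE) (auto simp: set_lebesgue_integral_def)
  finally show "(\<integral>z\<in>S. h z \<partial>(M1 \<Otimes>\<^sub>M M2)) = 0" .
qed

text \<open>For measurable \<open>B\<close>, exchanging the order of integration gives
  \<open>\<integral>(\<integral>y\<in>B. h(x,y) \<partial>R) \<partial>Q = \<integral>y\<in>B. (\<integral>h(x,y) \<partial>Q) \<partial>R = 0\<close> for every \<open>Q\<close> in the model. The null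
  set of the hypothesis may depend on \<open>Q\<close>, whereas the function \<open>x \<mapsto> \<integral>y\<in>B. h(x,y) \<partial>R\<close> does not, so
  completeness applies to it.\<close>

lemma AE_zero_if_averages_zero_of_complete_model:
  fixes h :: "'a \<times> 'b \<Rightarrow> real"
  assumes model: "\<Q> \<subseteq> Prob M"
    and complete: "complete_model M \<Q>"
    and R: "R \<in> Prob N"
    and h_meas: "h \<in> borel_measurable (M \<Otimes>\<^sub>M N)"
    and h_int: "\<And>Q. Q \<in> \<Q> \<Longrightarrow> integrable (Q \<Otimes>\<^sub>M R) h"
    and average: "\<And>Q. Q \<in> \<Q> \<Longrightarrow> AE y in R. (\<integral>x. h (x, y) \<partial>Q) = 0"
    and Q: "Q \<in> \<Q>"
  shows "AE z in Q \<Otimes>\<^sub>M R. h z = 0"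
proof -
  have R_sets [measurable_cong]: "sets R = sets N" and "prob_space R"
    using R by (auto simp: space_prob_algebra)
  interpret R: prob_space R by fact
  have prob: "prob_space P" if "P \<in> \<Q>" for P
    using model that by (auto simp: space_prob_algebra)
  have pair: "pair_sigma_finite P R" if "P \<in> \<Q>" for P
    using prob_space_imp_sigma_finite[OF prob[OF that]] R.sigma_finite_measure_axioms
    by (rule pair_sigma_finite.intro)
  have "AE x in Q. (\<integral>y\<in>B. h (x, y) \<partial>R) = 0" if B: "B \<in> sets R" for B
  proof -
    let ?f = "\<lambda>x. \<integral>y\<in>B. h (x, y) \<partial>R"
    have f_meas: "?f \<in> borel_measurable M"
      unfolding set_lebesgue_integral_def using B h_meas by measurable
    have f: "integrable P ?f \<and> (\<integral>x. ?f x \<partial>P) = 0" if P: "P \<in> \<Q>" for P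
    proof -
      interpret pair_sigma_finite P R by (rule pair[OF P])
      let ?k = "\<lambda>x y. indicator B y *\<^sub>R h (x, y)"
      have "integrable (P \<Otimes>\<^sub>M R) (\<lambda>z. indicator (space P \<times> B) z *\<^sub>R h z)"
        using B h_int[OF P] by (intro integrable_mult_indicator) auto
      also have "?this \<longleftrightarrow> integrable (P \<Otimes>\<^sub>M R) (case_prod ?k)"
        by (intro Bochner_Integration.integrable_cong) (auto simp: space_pair_measure indicator_def)
      finally have k: "integrable (P \<Otimes>\<^sub>M R) (case_prod ?k)" .
      have "(\<integral>x. ?f x \<partial>P) = (\<integral>y. (\<integral>x. ?k x y \<partial>P) \<partial>R)"
        unfolding set_lebesgue_integral_def by (rule Fubini_integral[OF k, symmetric])
      also have "\<dots> = (\<integral>y. indicator B y *\<^sub>R (\<integral>x. h (x, y) \<partial>P) \<partial>R)"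
        by simp
      also have "\<dots> = 0"
        using average[OF P] by (intro integral_eq_zero_AE) auto
      finally show ?thesis
        using integrable_fst[OF k] by (simp add: set_lebesgue_integral_def)
    qed
    show ?thesis
      using complete f_meas f Q unfolding complete_model_def L1_def by blast
  qed
  with pair[OF Q] h_int[OF Q] show ?thesis
    by (rule pair_sigma_finite.AE_zero_if_section_set_integrals_zero)
qed

theorem theorem1p3:
  fixes \<Theta>1 :: "'i set" and \<Theta>2 :: "'j set"
    and M1 :: "'a measure" and M2 :: "'b measure"
    and Q :: "'i \<Rightarrow> 'a measure" and R :: "'i \<Rightarrow> 'j \<Rightarrow> 'b measure"
  assumes Q_model: "{Q \<theta>1 | \<theta>1. \<theta>1 \<in> \<Theta>1} \<subseteq> Prob M1"
    and R_model: "{R \<theta>1 \<theta>2 | \<theta>1 \<theta>2. \<theta>1 \<in> \<Theta>1 \<and> \<theta>2 \<in> \<Theta>2} \<subseteq> Prob M2"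
    and Q_complete: "complete_model M1 {Q \<theta>1 | \<theta>1. \<theta>1 \<in> \<Theta>1}"
    and R_complete: "\<And>\<theta>1. \<theta>1 \<in> \<Theta>1 \<Longrightarrow> complete_model M2 {R \<theta>1 \<theta>2 | \<theta>2. \<theta>2 \<in> \<Theta>2}"
    and R_homogeneous: "\<And>\<theta>2. \<theta>2 \<in> \<Theta>2 \<Longrightarrow> homogeneous_model {R \<theta>1 \<theta>2 | \<theta>1. \<theta>1 \<in> \<Theta>1}"
    and L1_eq: "L1 (M1 \<Otimes>\<^sub>M M2) {Q \<theta>1 \<Otimes>\<^sub>M R \<theta>1 \<theta>2 | \<theta>1 \<theta>2. \<theta>1 \<in> \<Theta>1 \<and> \<theta>2 \<in> \<Theta>2} =
      L1 (M1 \<Otimes>\<^sub>M M2) {Q \<theta>1 \<Otimes>\<^sub>M R \<theta>1' \<theta>2 | \<theta>1 \<theta>1' \<theta>2. \<theta>1 \<in> \<Theta>1 \<and> \<theta>1' \<in> \<Theta>1 \<and> \<theta>2 \<in> \<Theta>2}"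
  shows "complete_model (M1 \<Otimes>\<^sub>M M2)
    {Q \<theta>1 \<Otimes>\<^sub>M R \<theta>1 \<theta>2 | \<theta>1 \<theta>2. \<theta>1 \<in> \<Theta>1 \<and> \<theta>2 \<in> \<Theta>2}"
proof -
  let ?P = "{Q \<theta>1 \<Otimes>\<^sub>M R \<theta>1 \<theta>2 | \<theta>1 \<theta>2. \<theta>1 \<in> \<Theta>1 \<and> \<theta>2 \<in> \<Theta>2}"
  have Q_prob: "prob_space (Q i)" and Q_sets: "sets (Q i) = sets M1" if "i \<in> \<Theta>1" for i
    using Q_model that by (auto simp: space_prob_algebra)
  have R_Prob: "R i j \<in> Prob M2" if "i \<in> \<Theta>1" "j \<in> \<Theta>2" for i j
    using R_model that by blast
  then have R_prob: "prob_space (R i j)" and R_sets: "sets (R i j) = sets M2"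
    if "i \<in> \<Theta>1" "j \<in> \<Theta>2" for i j
    using that by (auto simp: space_prob_algebra)
  have "AE z in Q k \<Otimes>\<^sub>M R k j. h z = 0"
    if h: "h \<in> L1 (M1 \<Otimes>\<^sub>M M2) ?P" and zero: "\<forall>P\<in>?P. (\<integral>z. h z \<partial>P) = 0"
      and k: "k \<in> \<Theta>1" and j: "j \<in> \<Theta>2" for h k j
  proof -
    have h_meas: "h \<in> borel_measurable (M1 \<Otimes>\<^sub>M M2)"
      using h by (simp add: L1_def)
    have h_int: "integrable (Q i \<Otimes>\<^sub>M R i' j') h" if "i \<in> \<Theta>1" "i' \<in> \<Theta>1" "j' \<in> \<Theta>2" for i i' j'
      using h that unfolding L1_eq by (auto simp: L1_def)
    have average: "AE y in R k j. (\<integral>x. h (x, y) \<partial>Q i) = 0" if i: "i \<in> \<Theta>1" for i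
    proof -
      let ?g = "\<lambda>y. \<integral>x. h (x, y) \<partial>Q i"
      interpret Q: prob_space "Q i" by (rule Q_prob[OF i])
      note Q_sets[OF i, measurable_cong]
      have g_meas: "?g \<in> borel_measurable M2"
        using h_meas by measurable
      have g: "integrable (R i j') ?g \<and> (\<integral>y. ?g y \<partial>R i j') = 0" if j': "j' \<in> \<Theta>2" for j'
      proof -
        interpret R: prob_space "R i j'" by (rule R_prob[OF i j'])
        interpret pair_sigma_finite "Q i" "R i j'" ..
        have "integrable (Q i \<Otimes>\<^sub>M R i j') (case_prod (\<lambda>x y. h (x, y)))"
          using h_int[OF i i j'] by simp
        from integrable_snd[OF this] integral_snd[OF this] show ?thesis
          using zero i j' by auto
      qed
      have "AE y in R i j. ?g y = 0"
        using R_complete[OF i] g_meas g j unfolding complete_model_def L1_def by blast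
      moreover have "absolutely_continuous (R i j) (R k j)"
        using R_homogeneous[OF j] i k unfolding homogeneous_model_def by blast
      ultimately show ?thesis
        using R_sets i j k by (intro absolutely_continuous_AE[of "R k j" "R i j"]) auto
    qed
    show ?thesis
      using k j h_int average
      by (intro AE_zero_if_averages_zero_of_complete_model[OF Q_model Q_complete R_Prob[OF k j] h_meas]) auto
  qed
  then show ?thesis
    unfolding complete_model_def by blast
qed

end
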